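(* Let $\mu$ be a complex Borel measure on $\mathbb{R}$ with finite absolute moments and quasi-definite moment matrix $G$. Then for $k\ge1$ its monic orthogonal polynomial of degree $k$ is $$P_k(x)=\frac{1}{k!\,\det G^{[k]}}\int\prod_{j=1}^k(x-x_j)\prod_{1\le j<n\le k}(x_n-x_j)^2\,d\mu(x_1)\,d\mu(x_2)\cdots d\mu(x_k).$$
   Context: $G=(G_{i,j})_{i,j\ge0}$, $G_{i,j}=\int x^{i+j}d\mu(x)$, and $G^{[k]}=(G_{i,j})_{i,j=0}^{k-1}$. Quasi-definite means $\det G^{[k]}\neq0$ for all $k\ge1$. Then uniquely $G=S^{-1}HS^{-\top}$ with $S$ lower unitriangular and $H$ diagonal, and the monic orthogonal polynomials $P_k$ are the entries of $S(1,x,x^2,\dots)^\top$. *)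

theory Defs
  imports "HOL-Analysis.Bochner_Integration" "Jordan_Normal_Form.Determinant"
begin

text \<open>
  A complex Borel measure on the real line is represented by its set function;
  the values on sets that are not Borel are never used.
\<close>

definition complex_borel_measure :: "(real set \<Rightarrow> complex) \<Rightarrow> bool" where
  "complex_borel_measure \<mu> \<longleftrightarrow>
     \<mu> {} = 0 \<and>
     (\<forall>A :: nat \<Rightarrow> real set. range A \<subseteq> sets borel \<longrightarrow> disjoint_family A \<longrightarrow>
        (\<lambda>i. \<mu> (A i)) sums \<mu> (\<Union>i. A i))"

text \<open>
  The total variation is the supremum over countable Borel partitions.
  For a countably additive set function this is countably additive, so that
  \<^const>\<open>measure_of\<close> does not fall back to the zero measure.
\<close>

definition total_variation :: "(real set \<Rightarrow> 'b::real_normed_vector) \<Rightarrow> real measure" where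
  "total_variation \<nu> = measure_of UNIV (sets borel)
     (\<lambda>E. SUP A \<in> {A :: nat \<Rightarrow> real set.
              range A \<subseteq> sets borel \<and> disjoint_family A \<and> (\<Union>i. A i) = E}.
            (\<Sum>i. ennreal (norm (\<nu> (A i)))))"

definition finite_abs_moments :: "(real set \<Rightarrow> complex) \<Rightarrow> bool" where
  "finite_abs_moments \<mu> \<longleftrightarrow>
     (\<forall>n::nat. (\<integral>\<^sup>+ x. ennreal (\<bar>x\<bar> ^ n) \<partial>total_variation \<mu>) < \<infinity>)"

text \<open>
  Jordan decomposition of a finite signed measure:
  the positive part is half the sum of the total variation and the measure,
  and the negative part is the positive part of the negated measure.
\<close>

definition positive_part :: "(real set \<Rightarrow> real) \<Rightarrow> real measure" where
  "positive_part \<nu> = measure_of UNIV (sets borel)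
     (\<lambda>E. ennreal ((measure (total_variation \<nu>) E + \<nu> E) / 2))"

definition signed_integral :: "(real set \<Rightarrow> real) \<Rightarrow> (real \<Rightarrow> complex) \<Rightarrow> complex" where
  "signed_integral \<nu> f =
     integral\<^sup>L (positive_part \<nu>) f - integral\<^sup>L (positive_part (\<lambda>E. - \<nu> E)) f"

definition complex_integral :: "(real set \<Rightarrow> complex) \<Rightarrow> (real \<Rightarrow> complex) \<Rightarrow> complex" where
  "complex_integral \<mu> f =
     signed_integral (\<lambda>E. Re (\<mu> E)) f + \<i> * signed_integral (\<lambda>E. Im (\<mu> E)) f"

text \<open>
  The integral of \<open>F\<close> against \<open>d\<mu>(x\<^sub>1) \<dots> d\<mu>(x\<^sub>k)\<close>, with \<open>x\<^sub>1\<close> innermost. The variables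
  are the values of a function at the indices \<open>1, \<dots>, k\<close>; all other values are 0.
\<close>

primrec multiple_integral ::
    "(real set \<Rightarrow> complex) \<Rightarrow> nat \<Rightarrow> ((nat \<Rightarrow> real) \<Rightarrow> complex) \<Rightarrow> complex" where
  "multiple_integral \<mu> 0 F = F (\<lambda>_. 0)"
| "multiple_integral \<mu> (Suc k) F =
     complex_integral \<mu> (\<lambda>s. multiple_integral \<mu> k (\<lambda>t. F (t(Suc k := s))))"

type_synonym semi_infinite = "nat \<Rightarrow> nat \<Rightarrow> complex"

definition moment_matrix :: "(real set \<Rightarrow> complex) \<Rightarrow> semi_infinite" where
  "moment_matrix \<mu> i j = complex_integral \<mu> (\<lambda>x. complex_of_real (x ^ (i + j)))"

definition truncation :: "semi_infinite \<Rightarrow> nat \<Rightarrow> complex mat" where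
  "truncation G k = mat k k (\<lambda>(i, j). G i j)"

definition quasi_definite :: "semi_infinite \<Rightarrow> bool" where
  "quasi_definite G \<longleftrightarrow> (\<forall>k\<ge>1. Determinant.det (truncation G k) \<noteq> 0)"

text \<open>
  In every product formed below the left factor is lower triangular, so each
  series has only finitely many nonzero terms.
\<close>

definition semi_infinite_mult :: "semi_infinite \<Rightarrow> semi_infinite \<Rightarrow> semi_infinite"
    (infixl \<open>\<odot>\<close> 70) where
  "A \<odot> B = (\<lambda>i j. \<Sum>l. A i l * B l j)"

definition semi_infinite_id :: semi_infinite where
  "semi_infinite_id = (\<lambda>i j. if i = j then 1 else 0)"

definition semi_infinite_transpose :: "semi_infinite \<Rightarrow> semi_infinite" where
  "semi_infinite_transpose A = (\<lambda>i j. A j i)"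

definition lower_unitriangular :: "semi_infinite \<Rightarrow> bool" where
  "lower_unitriangular S \<longleftrightarrow> (\<forall>i. S i i = 1) \<and> (\<forall>i j. i < j \<longrightarrow> S i j = 0)"

definition diagonal :: "semi_infinite \<Rightarrow> bool" where
  "diagonal H \<longleftrightarrow> (\<forall>i j. i \<noteq> j \<longrightarrow> H i j = 0)"

text \<open>\<open>G = S\<^sup>-\<^sup>1 H S\<^sup>-\<^sup>\<top>\<close>, where \<open>T\<close> plays the role of \<open>S\<^sup>-\<^sup>1\<close>.\<close>

definition cholesky_factorization ::
    "semi_infinite \<Rightarrow> semi_infinite \<Rightarrow> semi_infinite \<Rightarrow> bool" where
  "cholesky_factorization G S H \<longleftrightarrow>
     lower_unitriangular S \<and> diagonal H \<and>
     (\<exists>T. lower_unitriangular T \<and> S \<odot> T = semi_infinite_id \<and> T \<odot> S = semi_infinite_id \<and>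
          G = T \<odot> H \<odot> semi_infinite_transpose T)"

definition cholesky_factor :: "semi_infinite \<Rightarrow> semi_infinite" where
  "cholesky_factor G = (THE S. \<exists>H. cholesky_factorization G S H)"

text \<open>
  The entry with index \<open>k\<close> of \<open>S (1, x, x\<^sup>2, \<dots>)\<^sup>\<top>\<close>, which is a finite sum because
  \<open>S\<close> is lower triangular.
\<close>

definition monic_orthogonal_poly :: "(real set \<Rightarrow> complex) \<Rightarrow> nat \<Rightarrow> complex poly" where
  "monic_orthogonal_poly \<mu> k =
     (\<Sum>j\<le>k. monom (cholesky_factor (moment_matrix \<mu>) k j) j)"

end

theory Submission
  imports Defs "HOL-Analysis.Caratheodory"
begin

text \<open>
  The formula is due to Heine. Write \<open>m n\<close> for the moments and \<open>\<Delta>\<close> for the Vandermonde product.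
  The integrand equals \<open>\<Delta>(t\<^sub>1, \<dots>, t\<^sub>k, x) \<Delta>(t\<^sub>1, \<dots>, t\<^sub>k)\<close>. Expanding both Vandermonde determinants
  and integrating each monomial into a product of moments gives \<open>k! det D\<close>, where the first \<open>k\<close>
  rows of \<open>D\<close> are \<open>(m i, \<dots>, m (i + k))\<close> and the last row is \<open>(1, x, \<dots>, x\<^sup>k)\<close>
  (\<open>multiple_integral_vandermonde_product\<close>). Adding multiples of earlier columns to the last one
  turns its entries into the integrals of \<open>t\<^sup>i P\<^sub>k(t)\<close>, which vanish by orthogonality, and
  the corner into \<open>P\<^sub>k(x)\<close>; hence \<open>det D = det G\<^sup>[\<^sup>k\<^sup>] P\<^sub>k(x)\<close> (\<open>det_moments_with_powers\<close>).

  Two foundations have to be laid. The polynomial \<open>P\<^sub>k\<close> is defined through the factorization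
  \<open>G = S\<^sup>-\<^sup>1 H S\<^sup>-\<^sup>\<top>\<close>. Its factor \<open>S\<close> is characterized by the finite linear systems which express
  that row \<open>k\<close> is orthogonal to the monomials of lower degree; invertibility of the truncations
  makes these systems uniquely solvable (\<open>cholesky_factor_orthogonalizes\<close>). On the analytic side,
  the integral is the only place where the measure enters, and what is needed of it is linearity
  on polynomials, that is, integrability of \<open>x\<^sup>n\<close> against the four measures of the Jordan
  decompositions. They are dominated by the total variation of \<open>\<mu>\<close>, whose moments are finite by
  assumption; this uses that the total variation is a genuine measure
  (\<open>variation_countably_additive\<close>). Since the multiple integral is an iterated one, linearity of
  the single integral also evaluates it on polynomials (\<open>multiple_integral_polynomial\<close>).
\<close>

section \<open>The total variation is a measure\<close>

definition borel_partitions :: "real set \<Rightarrow> (nat \<Rightarrow> real set) set" where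
  "borel_partitions E = {A. range A \<subseteq> sets borel \<and> disjoint_family A \<and> (\<Union>i. A i) = E}"

definition variation :: "(real set \<Rightarrow> 'b::real_normed_vector) \<Rightarrow> real set \<Rightarrow> ennreal" where
  "variation \<nu> E = (SUP A \<in> borel_partitions E. \<Sum>i. ennreal (norm (\<nu> (A i))))"

lemma total_variation_eq_measure_of_variation:
  "total_variation \<nu> = measure_of UNIV (sets borel) (variation \<nu>)"
  unfolding total_variation_def variation_def borel_partitions_def ..

lemma norm_sums_le_suminf_ennreal:
  fixes f :: "nat \<Rightarrow> 'a::banach"
  assumes "f sums s"
  shows "ennreal (norm s) \<le> (\<Sum>i. ennreal (norm (f i)))"
proof (cases "(\<Sum>i. ennreal (norm (f i))) = \<infinity>")
  case False
  then have summable: "summable (\<lambda>i. norm (f i))"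
    by (intro summable_suminf_not_top) (auto simp: infinity_ennreal_def)
  then have "norm s \<le> (\<Sum>i. norm (f i))"
    using summable_norm[OF summable] assms by (simp add: sums_iff)
  then show ?thesis
    by (simp add: suminf_ennreal2[OF _ summable] ennreal_leI)
qed simp

lemma suminf_ennreal_swap:
  fixes f :: "nat \<Rightarrow> nat \<Rightarrow> ennreal"
  shows "(\<Sum>i. \<Sum>j. f i j) = (\<Sum>j. \<Sum>i. f i j)"
proof -
  have "(\<Sum>i. \<Sum>j. f i j) = (\<integral>\<^sup>+ i. (\<Sum>j. f i j) \<partial>count_space UNIV)"
    by (simp add: nn_integral_count_space_nat)
  also have "\<dots> = (\<Sum>j. \<integral>\<^sup>+ i. f i j \<partial>count_space UNIV)"
    by (rule nn_integral_suminf) simp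
  finally show ?thesis
    by (simp add: nn_integral_count_space_nat)
qed

lemma variation_upper:
  "A \<in> borel_partitions E \<Longrightarrow> (\<Sum>i. ennreal (norm (\<nu> (A i)))) \<le> variation \<nu> E"
  unfolding variation_def by (rule SUP_upper)

lemma singleton_partition:
  assumes "E \<in> sets borel"
  shows "(\<lambda>i. if i = 0 then E else {}) \<in> borel_partitions E"
  using assms by (auto simp: borel_partitions_def disjoint_family_on_def split: if_splits)

lemma norm_le_variation:
  assumes "\<nu> {} = 0" "E \<in> sets borel"
  shows "ennreal (norm (\<nu> E)) \<le> variation \<nu> E"
proof -
  have "(\<Sum>i. ennreal (norm (\<nu> (if i = 0 then E else {})))) = ennreal (norm (\<nu> E))"
    using assms by (subst suminf_finite[of "{0::nat}"]) auto
  then show ?thesis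
    using variation_upper[OF singleton_partition[OF assms(2)], of \<nu>] by simp
qed

lemma variation_empty:
  assumes "\<nu> {} = 0"
  shows "variation \<nu> {} = 0"
proof -
  have zero: "(\<Sum>i. ennreal (norm (\<nu> (A i)))) = 0" if "A \<in> borel_partitions {}" for A
  proof -
    have "A i = {}" for i
      using that by (auto simp: borel_partitions_def)
    then show ?thesis
      using assms by simp
  qed
  have "variation \<nu> {} \<le> 0"
    unfolding variation_def by (rule SUP_least) (simp only: zero order.refl)
  then show ?thesis
    by simp
qed

text \<open>
  A partition of each set together give a partition of the union, and the supremum may be
  taken over the two partitions independently. The two sequences are merged into one by
  the pairing of naturals: the rows with index \<open>0\<close> and \<open>1\<close> carry the partitions and all other
  rows are empty, so that the sum over the merged sequence is a double series.
\<close>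

lemma variation_superadditive:
  assumes "\<nu> {} = 0" "E \<in> sets borel" "F \<in> sets borel" "E \<inter> F = {}"
  shows "variation \<nu> E + variation \<nu> F \<le> variation \<nu> (E \<union> F)"
proof -
  let ?s = "\<lambda>A. \<Sum>i. ennreal (norm (\<nu> (A i)))"
  have joint: "?s A + ?s B \<le> variation \<nu> (E \<union> F)"
    if A: "A \<in> borel_partitions E" and B: "B \<in> borel_partitions F" for A B
  proof -
    define C :: "nat \<times> nat \<Rightarrow> real set" where
      "C = (\<lambda>(i, j). if i = 0 then A j else if i = 1 then B j else {})"
    have C_disjoint: "C p \<inter> C q = {}" if "p \<noteq> q" for p q
    proof -
      obtain i j i' j' where [simp]: "p = (i, j)" "q = (i', j')"
        by (metis surj_pair)
      have "A j \<inter> A j' = {}" "B j \<inter> B j' = {}" if "j \<noteq> j'"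
        using A B that by (auto simp: borel_partitions_def disjoint_family_on_def)
      moreover have "A a \<inter> B b = {}" "B b \<inter> A a = {}" for a b
        using A B assms(4) unfolding borel_partitions_def by blast+
      ultimately show ?thesis
        using \<open>p \<noteq> q\<close> by (auto simp: C_def split: if_splits)
    qed
    have C_union: "(\<Union>p. C p) = E \<union> F"
    proof -
      have "A j \<subseteq> (\<Union>p. C p)" "B j \<subseteq> (\<Union>p. C p)" for j
        using UN_upper[of "(0, j)" UNIV C] UN_upper[of "(1, j)" UNIV C] by (simp_all add: C_def)
      then have "(\<Union>j. A j) \<union> (\<Union>j. B j) \<subseteq> (\<Union>p. C p)"
        by blast
      moreover have "(\<Union>p. C p) \<subseteq> (\<Union>j. A j) \<union> (\<Union>j. B j)"
        by (auto simp: C_def split: if_splits)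
      ultimately have "(\<Union>p. C p) = (\<Union>j. A j) \<union> (\<Union>j. B j)"
        by blast
      then show ?thesis
        using A B by (simp add: borel_partitions_def)
    qed
    have "(\<lambda>n. C (prod_decode n)) \<in> borel_partitions (E \<union> F)"
      unfolding borel_partitions_def
    proof (intro CollectI conjI)
      have "A j \<in> sets borel" "B j \<in> sets borel" for j
        using A B by (auto simp: borel_partitions_def)
      then have "C p \<in> sets borel" for p
        by (simp add: C_def split: prod.split)
      then show "range (\<lambda>n. C (prod_decode n)) \<subseteq> sets borel"
        by blast
      show "disjoint_family (\<lambda>n. C (prod_decode n))"
        unfolding disjoint_family_on_def by (intro ballI impI C_disjoint) (simp add: prod_decode_eq)
      have "(\<Union>n. C (prod_decode n)) = (\<Union>p\<in>range prod_decode. C p)"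
        by (simp only: image_image)
      then show "(\<Union>n. C (prod_decode n)) = E \<union> F"
        using C_union by (simp add: surj_prod_decode)
    qed
    then have "(\<Sum>n. ennreal (norm (\<nu> (C (prod_decode n))))) \<le> variation \<nu> (E \<union> F)"
      by (rule variation_upper)
    also have "(\<Sum>n. ennreal (norm (\<nu> (C (prod_decode n))))) =
        (\<Sum>i. \<Sum>j. ennreal (norm (\<nu> (C (i, j)))))"
      by (rule suminf_ennreal_2dimen) simp
    also have "\<dots> = (\<Sum>i\<in>{0, 1}. \<Sum>j. ennreal (norm (\<nu> (C (i, j)))))"
      using assms(1) by (intro suminf_finite) (auto simp: C_def)
    also have "\<dots> = ?s A + ?s B"
      by (simp add: C_def)
    finally show ?thesis .
  qed
  have nonempty: "borel_partitions E \<noteq> {}" "borel_partitions F \<noteq> {}"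
    using singleton_partition assms by blast+
  have left: "?s A + variation \<nu> F \<le> variation \<nu> (E \<union> F)" if "A \<in> borel_partitions E" for A
  proof -
    have "variation \<nu> F + ?s A = (SUP B\<in>borel_partitions F. ?s B + ?s A)"
      unfolding variation_def using nonempty by (simp add: ennreal_SUP_add_left)
    also have "\<dots> \<le> variation \<nu> (E \<union> F)"
    proof (rule SUP_least)
      fix B assume "B \<in> borel_partitions F"
      with that show "?s B + ?s A \<le> variation \<nu> (E \<union> F)"
        unfolding add.commute[of "?s B"] by (rule joint)
    qed
    finally show ?thesis
      by (simp add: add.commute)
  qed
  have "variation \<nu> E + variation \<nu> F = (SUP A\<in>borel_partitions E. ?s A + variation \<nu> F)"
    unfolding variation_def[of \<nu> E] using nonempty by (simp add: ennreal_SUP_add_left)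
  also have "\<dots> \<le> variation \<nu> (E \<union> F)"
    using left by (rule SUP_least)
  finally show ?thesis .
qed

lemma variation_mono:
  assumes "\<nu> {} = 0" "E \<in> sets borel" "F \<in> sets borel" "E \<subseteq> F"
  shows "variation \<nu> E \<le> variation \<nu> F"
proof -
  have "variation \<nu> E + variation \<nu> (F - E) \<le> variation \<nu> (E \<union> (F - E))"
    using assms by (intro variation_superadditive) auto
  moreover have "E \<union> (F - E) = F"
    using assms by auto
  ultimately show ?thesis
    using order.trans[OF add_increasing2[of "variation \<nu> (F - E)" "variation \<nu> E" "variation \<nu> E"]]
    by simp
qed

text \<open>
  Superadditivity bounds every partial sum of \<open>\<Sum>i. variation \<mu> (F i)\<close> by the variation of the
  union. Conversely, a partition \<open>A\<close> of the union is refined by the sets \<open>A j \<inter> F i\<close>; the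
  triangle inequality bounds the sum over \<open>A\<close> by the double sum over the refinement, and for
  each fixed \<open>i\<close> the refinement is a partition of \<open>F i\<close>.
\<close>

lemma variation_countably_additive:
  assumes \<mu>: "complex_borel_measure \<mu>"
  shows "countably_additive (sets borel) (variation \<mu>)"
  unfolding countably_additive_def
proof (intro allI impI antisym)
  fix F :: "nat \<Rightarrow> real set"
  assume F: "range F \<subseteq> sets borel" "disjoint_family F" "(\<Union>i. F i) \<in> sets borel"
  have empty: "\<mu> {} = 0"
    using \<mu> by (simp add: complex_borel_measure_def)
  have F_borel: "F i \<in> sets borel" for i
    using F(1) by auto
  have partial: "(\<Sum>i<n. variation \<mu> (F i)) \<le> variation \<mu> (\<Union>i<n. F i)" for n
  proof (induction n)
    case (Suc n)
    have "(\<Sum>i<Suc n. variation \<mu> (F i)) \<le> variation \<mu> (\<Union>i<n. F i) + variation \<mu> (F n)"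
      using Suc by (simp add: add_right_mono)
    also have "\<dots> \<le> variation \<mu> ((\<Union>i<n. F i) \<union> F n)"
    proof (rule variation_superadditive)
      have "F i \<inter> F n = {}" if "i < n" for i
        using F(2) that by (simp add: disjoint_family_on_def)
      then show "(\<Union>i<n. F i) \<inter> F n = {}"
        by blast
    qed (use F_borel empty in auto)
    also have "(\<Union>i<n. F i) \<union> F n = (\<Union>i<Suc n. F i)"
      by (auto simp: less_Suc_eq)
    finally show ?case .
  qed simp
  have "(\<Sum>i<n. variation \<mu> (F i)) \<le> variation \<mu> (\<Union>i. F i)" for n
    using F_borel empty by (intro order.trans[OF partial] variation_mono) auto
  then show "(\<Sum>i. variation \<mu> (F i)) \<le> variation \<mu> (\<Union>i. F i)"
    unfolding suminf_eq_SUP by (rule SUP_least)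

  show "variation \<mu> (\<Union>i. F i) \<le> (\<Sum>i. variation \<mu> (F i))"
    unfolding variation_def[of \<mu> "\<Union>i. F i"]
  proof (rule SUP_least)
    fix A assume "A \<in> borel_partitions (\<Union>i. F i)"
    then have A: "A j \<in> sets borel" "disjoint_family A" "(\<Union>j. A j) = (\<Union>i. F i)" for j
      by (auto simp: borel_partitions_def)
    have "(\<lambda>i. \<mu> (A j \<inter> F i)) sums \<mu> (A j)" for j
    proof -
      have "(\<lambda>i. \<mu> (A j \<inter> F i)) sums \<mu> (\<Union>i. A j \<inter> F i)"
      proof -
        have "range (\<lambda>i. A j \<inter> F i) \<subseteq> sets borel"
          using A(1) F_borel by auto
        moreover have "disjoint_family (\<lambda>i. A j \<inter> F i)"
          using F(2) by (auto simp: disjoint_family_on_def)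
        ultimately show ?thesis
          using \<mu> unfolding complex_borel_measure_def by blast
      qed
      moreover have "(\<Union>i. A j \<inter> F i) = A j"
        using A(3) by blast
      ultimately show ?thesis
        by simp
    qed
    then have "(\<Sum>j. ennreal (norm (\<mu> (A j)))) \<le>
        (\<Sum>j. \<Sum>i. ennreal (norm (\<mu> (A j \<inter> F i))))"
      by (intro suminf_le norm_sums_le_suminf_ennreal) auto
    also have "\<dots> = (\<Sum>i. \<Sum>j. ennreal (norm (\<mu> (A j \<inter> F i))))"
      by (rule suminf_ennreal_swap)
    also have "\<dots> \<le> (\<Sum>i. variation \<mu> (F i))"
    proof (intro suminf_le variation_upper)
      show "(\<lambda>j. A j \<inter> F i) \<in> borel_partitions (F i)" for i
        using A F_borel[of i] by (auto simp: borel_partitions_def disjoint_family_on_def)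
    qed auto
    finally show "(\<Sum>j. ennreal (norm (\<mu> (A j)))) \<le> (\<Sum>i. variation \<mu> (F i))" .
  qed
qed

text \<open>
  Countable additivity is what rules out the zero measure that \<^const>\<open>measure_of\<close> returns for
  other set functions. Hence the finiteness of the absolute moments says something about \<open>\<mu>\<close>.
\<close>

lemma emeasure_total_variation:
  assumes "complex_borel_measure \<mu>" "E \<in> sets borel"
  shows "emeasure (total_variation \<mu>) E = variation \<mu> E"
  unfolding total_variation_eq_measure_of_variation
proof (rule emeasure_measure_of_sigma)
  show "sigma_algebra UNIV (sets (borel :: real measure))"
    using sets.sigma_algebra_axioms[of "borel :: real measure"] by simp
  show "positive (sets borel) (variation \<mu>)"
    using assms(1) by (auto simp: positive_def complex_borel_measure_def intro: variation_empty)
qed (use assms variation_countably_additive in auto)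

section \<open>The integral is linear on polynomials\<close>

lemma sets_total_variation: "sets (total_variation \<nu>) = sets borel"
  unfolding total_variation_def
  using sets.sigma_sets_eq[of "borel :: real measure"] by (simp add: sets_measure_of)

lemma sets_positive_part: "sets (positive_part \<nu>) = sets borel"
  unfolding positive_part_def
  using sets.sigma_sets_eq[of "borel :: real measure"] by (simp add: sets_measure_of)

text \<open>
  For \<open>\<nu>\<close> one of \<open>\<plusminus> Re \<mu>\<close>, \<open>\<plusminus> Im \<mu>\<close>, the average of the variation of \<open>\<nu>\<close> and \<open>\<nu>\<close> itself is at
  most the variation of \<open>\<mu>\<close>. A measure built by \<^const>\<open>measure_of\<close> either takes the values of
  its set function or vanishes identically, and the inequality holds in both cases.
\<close>

lemma positive_part_le_total_variation:
  assumes \<mu>: "complex_borel_measure \<mu>"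
    and \<nu>: "\<And>E. \<bar>\<nu> E\<bar> \<le> norm (\<mu> E)"
  shows "positive_part \<nu> \<le> total_variation \<mu>"
proof -
  have bound: "emeasure (positive_part \<nu>) E \<le> emeasure (total_variation \<mu>) E"
    if E: "E \<in> sets borel" for E
  proof -
    have empty: "\<mu> {} = 0"
      using \<mu> by (simp add: complex_borel_measure_def)
    have "variation \<nu> E \<le> variation \<mu> E"
      unfolding variation_def using \<nu>
      by (intro SUP_mono) (auto intro!: bexI suminf_le ennreal_leI)
    then have TV: "emeasure (total_variation \<nu>) E \<le> variation \<mu> E"
      unfolding total_variation_eq_measure_of_variation by (simp add: emeasure_measure_of_conv)
    have point: "ennreal (\<nu> E) \<le> variation \<mu> E"
      using norm_le_variation[of \<mu> E, OF empty E] \<nu>[of E]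
      by (meson abs_ge_self ennreal_leI order.trans)
    have "ennreal ((measure (total_variation \<nu>) E + \<nu> E) / 2) \<le> variation \<mu> E"
    proof (cases "variation \<mu> E")
      case (real v)
      then have "measure (total_variation \<nu>) E \<le> v"
        using TV by (simp add: measure_def enn2real_leI)
      moreover have "\<nu> E \<le> v"
        using point real by (cases "\<nu> E \<ge> 0") auto
      ultimately show ?thesis
        using real by (auto intro: ennreal_leI)
    qed simp
    then have "emeasure (positive_part \<nu>) E \<le> variation \<mu> E"
      unfolding positive_part_def by (simp add: emeasure_measure_of_conv)
    then show ?thesis
      using emeasure_total_variation[OF \<mu> E] by simp
  qed
  have "emeasure (positive_part \<nu>) E \<le> emeasure (total_variation \<mu>) E" for E
    by (cases "E \<in> sets borel") (auto simp: bound emeasure_notin_sets sets_positive_part)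
  moreover have "space (positive_part \<nu>) = space (total_variation \<mu>)"
    using sets_eq_imp_space_eq[of "positive_part \<nu>" "total_variation \<mu>"]
    by (simp add: sets_positive_part sets_total_variation)
  ultimately show ?thesis
    by (simp add: le_measure_iff le_fun_def sets_positive_part sets_total_variation)
qed

lemma integrable_power_positive_part:
  assumes \<mu>: "complex_borel_measure \<mu>" "finite_abs_moments \<mu>"
    and \<nu>: "\<And>E. \<bar>\<nu> E\<bar> \<le> norm (\<mu> E)"
  shows "integrable (positive_part \<nu>) (\<lambda>x. complex_of_real (x ^ n))"
proof (rule integrableI_bounded)
  have "(\<lambda>x::real. complex_of_real (x ^ n)) \<in> borel_measurable borel"
    by measurable
  then show "(\<lambda>x. complex_of_real (x ^ n)) \<in> borel_measurable (positive_part \<nu>)"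
    by (simp cong: measurable_cong_sets add: sets_positive_part)
  have "(\<integral>\<^sup>+ x. ennreal (norm (complex_of_real (x ^ n))) \<partial>positive_part \<nu>) =
      (\<integral>\<^sup>+ x. ennreal (\<bar>x\<bar> ^ n) \<partial>positive_part \<nu>)"
    by (simp only: norm_of_real power_abs)
  also have "\<dots> \<le> (\<integral>\<^sup>+ x. ennreal (\<bar>x\<bar> ^ n) \<partial>total_variation \<mu>)"
    using positive_part_le_total_variation[OF \<mu>(1) \<nu>]
    by (intro nn_integral_mono_measure) (auto simp: sets_positive_part sets_total_variation)
  also have "\<dots> < \<infinity>"
    using \<mu>(2) by (simp add: finite_abs_moments_def)
  finally show "(\<integral>\<^sup>+ x. ennreal (norm (complex_of_real (x ^ n))) \<partial>positive_part \<nu>) < \<infinity>" .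
qed

lemma signed_integral_polynomial:
  assumes \<mu>: "complex_borel_measure \<mu>" "finite_abs_moments \<mu>"
    and \<nu>: "\<And>E. \<bar>\<nu> E\<bar> \<le> norm (\<mu> E)"
  shows "signed_integral \<nu> (\<lambda>x. \<Sum>a\<in>I. c a * complex_of_real (x ^ e a)) =
    (\<Sum>a\<in>I. c a * signed_integral \<nu> (\<lambda>x. complex_of_real (x ^ e a)))"
proof -
  have part: "integral\<^sup>L (positive_part \<nu>') (\<lambda>x. \<Sum>a\<in>I. c a * complex_of_real (x ^ e a)) =
      (\<Sum>a\<in>I. c a * integral\<^sup>L (positive_part \<nu>') (\<lambda>x. complex_of_real (x ^ e a)))"
    if "\<And>E. \<bar>\<nu>' E\<bar> \<le> norm (\<mu> E)" for \<nu>' :: "real set \<Rightarrow> real"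
  proof -
    have int: "integrable (positive_part \<nu>') (\<lambda>x. complex_of_real (x ^ n))" for n
      using \<mu> that by (rule integrable_power_positive_part)
    show ?thesis
      using int by (simp only: Bochner_Integration.integral_sum integrable_mult_right
          integral_mult_right)
  qed
  show ?thesis
    unfolding signed_integral_def
    using \<nu> by (simp only: part[of \<nu>] part[of "\<lambda>E. - \<nu> E"] abs_minus_cancel
        sum_subtractf right_diff_distrib)
qed

lemma complex_integral_polynomial:
  assumes "complex_borel_measure \<mu>" "finite_abs_moments \<mu>"
  shows "complex_integral \<mu> (\<lambda>x. \<Sum>a\<in>I. c a * complex_of_real (x ^ e a)) =
    (\<Sum>a\<in>I. c a * complex_integral \<mu> (\<lambda>x. complex_of_real (x ^ e a)))"
proof -
  note linear = signed_integral_polynomial[OF assms, where I = I and c = c and e = e]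
  show ?thesis
    unfolding complex_integral_def
    by (simp only: linear[of "\<lambda>E. Re (\<mu> E)", OF abs_Re_le_cmod]
        linear[of "\<lambda>E. Im (\<mu> E)", OF abs_Im_le_cmod])
      (simp add: sum.distrib sum_distrib_left algebra_simps)
qed

text \<open>
  On monomials the iterated integral splits into a product of moments: in each step the
  innermost integrals have already become constants, and the outermost one is an integral of
  a polynomial in one variable. Linearity of the single integral on polynomials thus does the
  work of Fubini's theorem.
\<close>

lemma multiple_integral_polynomial:
  assumes "complex_borel_measure \<mu>" "finite_abs_moments \<mu>"
  shows "multiple_integral \<mu> k
      (\<lambda>t. \<Sum>a\<in>I. c a * (\<Prod>i<k. complex_of_real (t (Suc i)) ^ e a i)) =
    (\<Sum>a\<in>I. c a * (\<Prod>i<k. complex_integral \<mu> (\<lambda>x. complex_of_real (x ^ e a i))))"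
proof (induction k arbitrary: c)
  case (Suc k)
  let ?m = "\<lambda>n. complex_integral \<mu> (\<lambda>x. complex_of_real (x ^ n))"
  have "multiple_integral \<mu> (Suc k)
      (\<lambda>t. \<Sum>a\<in>I. c a * (\<Prod>i<Suc k. complex_of_real (t (Suc i)) ^ e a i)) =
    complex_integral \<mu> (\<lambda>s. multiple_integral \<mu> k (\<lambda>t. \<Sum>a\<in>I.
      (c a * complex_of_real (s ^ e a k)) * (\<Prod>i<k. complex_of_real (t (Suc i)) ^ e a i)))"
    by (simp add: mult_ac)
  also have "\<dots> = complex_integral \<mu> (\<lambda>s. \<Sum>a\<in>I.
      (c a * (\<Prod>i<k. ?m (e a i))) * complex_of_real (s ^ e a k))"
    by (simp only: Suc.IH) (simp only: mult_ac)
  also have "\<dots> = (\<Sum>a\<in>I. (c a * (\<Prod>i<k. ?m (e a i))) * ?m (e a k))"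
    by (rule complex_integral_polynomial[OF assms])
  finally show ?case
    by (simp add: mult_ac)
qed simp



section \<open>Determinants and monic changes of the columns\<close>

text \<open>
  Replacing column \<open>j\<close> by itself plus a combination of earlier columns is multiplication by an
  upper triangular matrix with unit diagonal. Read with the monomials as columns, this says
  that they may be exchanged for any sequence of monic polynomials of the same degrees.
\<close>

lemma det_unitriangular_column_change:
  fixes M :: "nat \<Rightarrow> nat \<Rightarrow> 'a::comm_ring_1"
  assumes "\<And>j. c j j = 1"
  shows "Determinant.det (mat n n (\<lambda>(i, j). \<Sum>l\<le>j. c j l * M i l)) =
    Determinant.det (mat n n (\<lambda>(i, j). M i j))"
proof -
  define U where "U = mat n n (\<lambda>(l, j). if l \<le> j then c j l else 0)"
  have "mat n n (\<lambda>(i, j). \<Sum>l\<le>j. c j l * M i l) = mat n n (\<lambda>(i, j). M i j) * U"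
  proof (rule eq_matI)
    fix i j assume "i < dim_row (mat n n (\<lambda>(i, j). M i j) * U)"
      "j < dim_col (mat n n (\<lambda>(i, j). M i j) * U)"
    then have ij: "i < n" "j < n"
      by (auto simp: U_def)
    have "(\<Sum>l\<le>j. c j l * M i l) = (\<Sum>l\<in>{0..<n}. M i l * (if l \<le> j then c j l else 0))"
      using ij by (intro sum.mono_neutral_cong_left) auto
    then show "mat n n (\<lambda>(i, j). \<Sum>l\<le>j. c j l * M i l) $$ (i, j) =
        (mat n n (\<lambda>(i, j). M i j) * U) $$ (i, j)"
      using ij by (simp add: U_def scalar_prod_def)
  qed (simp_all add: U_def)
  moreover have "Determinant.det U = 1"
  proof -
    have "Determinant.det U = prod_list (diag_mat U)"
      by (rule det_upper_triangular[of _ n]) (auto simp: U_def upper_triangular_def)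
    also have "\<dots> = 1"
      unfolding prod_list_diag_prod using assms by (intro prod.neutral) (auto simp: U_def)
    finally show ?thesis .
  qed
  ultimately show ?thesis
    by (simp add: det_mult[of _ n] U_def)
qed

lemma det_lower_triangular_prod:
  fixes M :: "nat \<Rightarrow> nat \<Rightarrow> 'a::comm_ring_1"
  assumes "\<And>i j. i < j \<Longrightarrow> j < n \<Longrightarrow> M i j = 0"
  shows "Determinant.det (mat n n (\<lambda>(i, j). M i j)) = (\<Prod>i<n. M i i)"
proof -
  have "Determinant.det (mat n n (\<lambda>(i, j). M i j)) = prod_list (diag_mat (mat n n (\<lambda>(i, j). M i j)))"
    using assms by (intro det_lower_triangular[of n]) auto
  then show ?thesis
    by (simp add: prod_list_diag_prod atLeast0LessThan)
qed

text \<open>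
  Exchanging the monomials for the Newton polynomials \<open>\<Prod>l<j. (X - z l)\<close> makes the matrix lower
  triangular, because the polynomial of degree \<open>j\<close> vanishes at the nodes before \<open>z j\<close>.
\<close>

lemma det_vandermonde:
  fixes z :: "nat \<Rightarrow> 'a::idom"
  shows "Determinant.det (mat n n (\<lambda>(i, j). z i ^ j)) = (\<Prod>i<n. \<Prod>l<i. z i - z l)"
proof -
  define p where "p j = (\<Prod>l<j. [:- z l, 1:])" for j
  have deg: "degree (p j) = j" for j
    unfolding p_def by (subst degree_prod_eq_sum_degree) auto
  have monic: "coeff (p j) j = 1" for j
    using lead_coeff_prod[of "\<lambda>l. [:- z l, 1:]" "{..<j}"] deg[of j] by (simp add: p_def)
  have poly_p: "poly (p j) a = (\<Prod>l<j. a - z l)" for j a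
    by (simp add: p_def poly_prod)
  have "Determinant.det (mat n n (\<lambda>(i, j). z i ^ j)) =
      Determinant.det (mat n n (\<lambda>(i, j). \<Sum>l\<le>j. coeff (p j) l * z i ^ l))"
    by (rule det_unitriangular_column_change[OF monic, symmetric])
  also have "(\<lambda>(i, j). \<Sum>l\<le>j. coeff (p j) l * z i ^ l) = (\<lambda>(i, j). poly (p j) (z i))"
    by (simp add: poly_altdef deg)
  also have "Determinant.det (mat n n (\<lambda>(i, j). poly (p j) (z i))) = (\<Prod>i<n. poly (p i) (z i))"
    by (rule det_lower_triangular_prod) (auto simp: poly_p prod_zero_iff)
  finally show ?thesis
    by (simp add: poly_p)
qed

section \<open>Products of semi-infinite triangular matrices\<close>

text \<open>
  Products of semi-infinite matrices are series and need not be associative. Whenever the left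
  factor is lower triangular or the right factor upper triangular, each entry is a finite sum;
  the three associativity laws below cover the patterns of factors for which all products
  involved are of this kind.
\<close>

lemma semi_infinite_mult_left_lower:
  assumes "\<And>l. i < l \<Longrightarrow> A i l = 0"
  shows "(A \<odot> B) i j = (\<Sum>l\<le>i. A i l * B l j)"
  unfolding semi_infinite_mult_def using assms by (intro suminf_finite) auto

lemma semi_infinite_mult_right_upper:
  assumes "\<And>l. j < l \<Longrightarrow> B l j = 0"
  shows "(A \<odot> B) i j = (\<Sum>l\<le>j. A i l * B l j)"
  unfolding semi_infinite_mult_def using assms by (intro suminf_finite) auto

lemma semi_infinite_mult_assoc_lower_lower:
  assumes A: "\<And>i j. i < j \<Longrightarrow> A i j = 0" and B: "\<And>i j. i < j \<Longrightarrow> B i j = 0"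
  shows "(A \<odot> B) \<odot> C = A \<odot> (B \<odot> C)"
proof (intro ext)
  fix i j
  have AB: "(A \<odot> B) a b = (\<Sum>l\<le>a. A a l * B l b)" for a b
    by (rule semi_infinite_mult_left_lower) (rule A)
  have BC: "(B \<odot> C) a j = (\<Sum>m\<le>i. B a m * C m j)" if "a \<le> i" for a
  proof -
    have "(B \<odot> C) a j = (\<Sum>m\<le>a. B a m * C m j)"
      by (rule semi_infinite_mult_left_lower) (rule B)
    also have "\<dots> = (\<Sum>m\<le>i. B a m * C m j)"
      using that B by (intro sum.mono_neutral_left) auto
    finally show ?thesis .
  qed
  have "((A \<odot> B) \<odot> C) i j = (\<Sum>m\<le>i. (A \<odot> B) i m * C m j)"
    by (rule semi_infinite_mult_left_lower) (auto simp: AB A B intro!: sum.neutral)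
  also have "\<dots> = (\<Sum>m\<le>i. \<Sum>l\<le>i. A i l * B l m * C m j)"
    by (simp add: AB sum_distrib_right)
  also have "\<dots> = (\<Sum>l\<le>i. \<Sum>m\<le>i. A i l * B l m * C m j)"
    by (rule sum.swap)
  also have "\<dots> = (\<Sum>l\<le>i. A i l * (B \<odot> C) l j)"
    by (simp add: BC sum_distrib_left mult.assoc)
  also have "\<dots> = (A \<odot> (B \<odot> C)) i j"
    by (rule semi_infinite_mult_left_lower[symmetric]) (rule A)
  finally show "((A \<odot> B) \<odot> C) i j = (A \<odot> (B \<odot> C)) i j" .
qed

lemma semi_infinite_mult_assoc_lower_upper:
  assumes A: "\<And>i j. i < j \<Longrightarrow> A i j = 0" and C: "\<And>i j. j < i \<Longrightarrow> C i j = 0"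
  shows "(A \<odot> B) \<odot> C = A \<odot> (B \<odot> C)"
proof (intro ext)
  fix i j
  have AB: "(A \<odot> B) i b = (\<Sum>l\<le>i. A i l * B l b)" for b
    by (rule semi_infinite_mult_left_lower) (rule A)
  have BC: "(B \<odot> C) a j = (\<Sum>m\<le>j. B a m * C m j)" for a
    by (rule semi_infinite_mult_right_upper) (rule C)
  have "((A \<odot> B) \<odot> C) i j = (\<Sum>m\<le>j. (A \<odot> B) i m * C m j)"
    by (rule semi_infinite_mult_right_upper) (rule C)
  also have "\<dots> = (\<Sum>m\<le>j. \<Sum>l\<le>i. A i l * B l m * C m j)"
    by (simp add: AB sum_distrib_right)
  also have "\<dots> = (\<Sum>l\<le>i. \<Sum>m\<le>j. A i l * B l m * C m j)"
    by (rule sum.swap)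
  also have "\<dots> = (\<Sum>l\<le>i. A i l * (B \<odot> C) l j)"
    by (simp add: BC sum_distrib_left mult.assoc)
  also have "\<dots> = (A \<odot> (B \<odot> C)) i j"
    by (rule semi_infinite_mult_left_lower[symmetric]) (rule A)
  finally show "((A \<odot> B) \<odot> C) i j = (A \<odot> (B \<odot> C)) i j" .
qed

lemma semi_infinite_transpose_mult:
  "semi_infinite_transpose (A \<odot> B) = semi_infinite_transpose B \<odot> semi_infinite_transpose A"
  by (simp add: semi_infinite_transpose_def semi_infinite_mult_def mult.commute)

lemma semi_infinite_transpose_transpose [simp]:
  "semi_infinite_transpose (semi_infinite_transpose A) = A"
  by (simp add: semi_infinite_transpose_def)

lemma semi_infinite_mult_assoc_upper_upper:
  assumes B: "\<And>i j. j < i \<Longrightarrow> B i j = 0" and C: "\<And>i j. j < i \<Longrightarrow> C i j = 0"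
  shows "(A \<odot> B) \<odot> C = A \<odot> (B \<odot> C)"
proof -
  have "(semi_infinite_transpose C \<odot> semi_infinite_transpose B) \<odot> semi_infinite_transpose A =
      semi_infinite_transpose C \<odot> (semi_infinite_transpose B \<odot> semi_infinite_transpose A)"
    by (rule semi_infinite_mult_assoc_lower_lower)
      (simp_all add: semi_infinite_transpose_def B C)
  from arg_cong[OF this, of semi_infinite_transpose] show ?thesis
    by (simp add: semi_infinite_transpose_mult)
qed

lemma semi_infinite_mult_id [simp]:
  "semi_infinite_id \<odot> A = A" "A \<odot> semi_infinite_id = A"
proof -
  show "semi_infinite_id \<odot> A = A"
  proof (intro ext)
    fix i j
    have "(semi_infinite_id \<odot> A) i j = (\<Sum>l\<le>i. semi_infinite_id i l * A l j)"
      by (rule semi_infinite_mult_left_lower) (simp add: semi_infinite_id_def)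
    also have "\<dots> = A i j"
      by (simp add: semi_infinite_id_def if_distrib[of "\<lambda>y. y * _"] cong: if_cong)
    finally show "(semi_infinite_id \<odot> A) i j = A i j" .
  qed
  show "A \<odot> semi_infinite_id = A"
  proof (intro ext)
    fix i j
    have "(A \<odot> semi_infinite_id) i j = (\<Sum>l\<le>j. A i l * semi_infinite_id l j)"
      by (rule semi_infinite_mult_right_upper) (simp add: semi_infinite_id_def)
    also have "\<dots> = A i j"
      by (simp add: semi_infinite_id_def if_distrib[of "\<lambda>y. _ * y"] cong: if_cong)
    finally show "(A \<odot> semi_infinite_id) i j = A i j" .
  qed
qed

lemma lower_unitriangular_above: "lower_unitriangular S \<Longrightarrow> i < j \<Longrightarrow> S i j = 0"
  by (simp add: lower_unitriangular_def)

lemma lower_unitriangular_diag: "lower_unitriangular S \<Longrightarrow> S i i = 1"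
  by (simp add: lower_unitriangular_def)

text \<open>
  Forward substitution: entry \<open>(i, j)\<close> is read off from row \<open>i\<close> of \<open>S \<odot> T = 1\<close> and uses only the
  rows of \<open>T\<close> before \<open>i\<close>.
\<close>

function unitriangular_inverse :: "semi_infinite \<Rightarrow> semi_infinite" where
  "unitriangular_inverse S i j =
     (if i < j then 0 else if i = j then 1
      else - (\<Sum>l\<in>{j..<i}. S i l * unitriangular_inverse S l j))"
  by auto
termination
  by (relation "Wellfounded.measure (\<lambda>(S, i, j). i)") auto

declare unitriangular_inverse.simps [simp del]

lemma lower_unitriangular_inverse: "lower_unitriangular (unitriangular_inverse S)"
  by (simp add: lower_unitriangular_def unitriangular_inverse.simps)

lemma unitriangular_right_inverse:
  assumes S: "lower_unitriangular S"
  shows "S \<odot> unitriangular_inverse S = semi_infinite_id"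
proof (intro ext)
  fix i j
  let ?T = "unitriangular_inverse S"
  have T_above: "?T l j = 0" if "l < j" for l
    using that by (simp add: unitriangular_inverse.simps)
  have "(S \<odot> ?T) i j = (\<Sum>l\<le>i. S i l * ?T l j)"
    using S by (intro semi_infinite_mult_left_lower) (rule lower_unitriangular_above)
  also have "\<dots> = semi_infinite_id i j"
  proof (cases "i < j")
    case True
    then show ?thesis
      by (auto simp: semi_infinite_id_def T_above intro!: sum.neutral)
  next
    case False
    then have "(\<Sum>l\<le>i. S i l * ?T l j) = (\<Sum>l\<in>{j..i}. S i l * ?T l j)"
      by (intro sum.mono_neutral_right) (auto simp: T_above)
    also have "{j..i} = insert i {j..<i}"
      using False by auto
    also have "(\<Sum>l\<in>insert i {j..<i}. S i l * ?T l j) =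
        ?T i j + (\<Sum>l\<in>{j..<i}. S i l * ?T l j)"
      using S by (simp add: lower_unitriangular_diag)
    also have "\<dots> = semi_infinite_id i j"
      using False by (subst unitriangular_inverse.simps) (simp add: semi_infinite_id_def)
    finally show ?thesis .
  qed
  finally show "(S \<odot> ?T) i j = semi_infinite_id i j" .
qed

text \<open>
  The right inverse \<open>T\<close> is unitriangular too and so has a right inverse \<open>R\<close> itself; then
  \<open>S = S \<odot> (T \<odot> R) = R\<close>.
\<close>

lemma unitriangular_left_inverse:
  assumes S: "lower_unitriangular S"
  shows "unitriangular_inverse S \<odot> S = semi_infinite_id"
proof -
  define T where "T = unitriangular_inverse S"
  define R where "R = unitriangular_inverse T"
  have T: "lower_unitriangular T"
    unfolding T_def by (rule lower_unitriangular_inverse)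
  have ST: "S \<odot> T = semi_infinite_id"
    unfolding T_def using S by (rule unitriangular_right_inverse)
  have TR: "T \<odot> R = semi_infinite_id"
    unfolding R_def using T by (rule unitriangular_right_inverse)
  have "S = S \<odot> (T \<odot> R)"
    by (simp add: TR)
  also have "\<dots> = (S \<odot> T) \<odot> R"
    using S T by (intro semi_infinite_mult_assoc_lower_lower[symmetric])
      (auto intro: lower_unitriangular_above)
  also have "\<dots> = R"
    by (simp add: ST)
  finally show ?thesis
    using TR by (simp add: T_def)
qed

section \<open>The Cholesky factor by orthogonality\<close>

text \<open>
  The rows of \<open>S\<close> are the coefficients of monic polynomials, and the sum is the pairing under
  \<open>G\<close> of the polynomial of degree \<open>k\<close> with \<open>x\<^sup>j\<close>. These finite linear systems replace the
  factorization, which also mentions \<open>H\<close> and the inverse of \<open>S\<close>.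
\<close>

definition orthogonalizes :: "semi_infinite \<Rightarrow> semi_infinite \<Rightarrow> bool" where
  "orthogonalizes G S \<longleftrightarrow>
     lower_unitriangular S \<and> (\<forall>k j. j < k \<longrightarrow> (\<Sum>l\<le>k. S k l * G l j) = 0)"

text \<open>
  From \<open>G = T \<odot> H \<odot> T\<^sup>\<top>\<close> follows \<open>S \<odot> G = H \<odot> T\<^sup>\<top>\<close>, an upper triangular matrix; its entries
  below the diagonal are the pairings in question.
\<close>

lemma cholesky_factorization_orthogonalizes:
  assumes "cholesky_factorization G S H"
  shows "orthogonalizes G S"
proof -
  obtain T where S: "lower_unitriangular S" and H: "diagonal H" and T: "lower_unitriangular T"
    and ST: "S \<odot> T = semi_infinite_id" and G: "G = T \<odot> H \<odot> semi_infinite_transpose T"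
    using assms by (auto simp: cholesky_factorization_def)
  have S0: "S i j = 0" and T0: "T i j = 0" and H0: "H i j = 0" if "i < j" for i j
    using S T H that by (auto simp: lower_unitriangular_def diagonal_def)
  have TH0: "(T \<odot> H) i j = 0" if "i < j" for i j
    using that by (subst semi_infinite_mult_left_lower) (auto simp: T0 H0 intro!: sum.neutral)
  have "S \<odot> G = (S \<odot> (T \<odot> H)) \<odot> semi_infinite_transpose T"
    unfolding G by (rule semi_infinite_mult_assoc_lower_lower[symmetric]) (simp_all add: S0 TH0)
  also have "S \<odot> (T \<odot> H) = (S \<odot> T) \<odot> H"
    by (rule semi_infinite_mult_assoc_lower_lower[symmetric]) (simp_all add: S0 T0)
  finally have SG: "S \<odot> G = H \<odot> semi_infinite_transpose T"
    by (simp add: ST)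
  have "(\<Sum>l\<le>k. S k l * G l j) = 0" if "j < k" for k j
  proof -
    have "(\<Sum>l\<le>k. S k l * G l j) = (H \<odot> semi_infinite_transpose T) k j"
      unfolding SG[symmetric] by (rule semi_infinite_mult_left_lower[symmetric]) (rule S0)
    also have "\<dots> = (\<Sum>l\<le>k. H k l * T j l)"
      by (subst semi_infinite_mult_left_lower) (auto simp: H0 semi_infinite_transpose_def)
    also have "\<dots> = 0"
      using H that by (intro sum.neutral) (metis T0 diagonal_def mult_eq_0_iff)
    finally show ?thesis .
  qed
  then show ?thesis
    using S by (simp add: orthogonalizes_def)
qed

text \<open>
  Put \<open>H = S \<odot> G \<odot> S\<^sup>\<top>\<close>. As \<open>S \<odot> G\<close> vanishes below the diagonal, so does \<open>H\<close>; since \<open>G\<close> is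
  symmetric, so is \<open>H\<close>, which is therefore diagonal. Cancelling \<open>S\<close> on both sides with its
  inverse gives the factorization of \<open>G\<close>.
\<close>

lemma orthogonalizes_cholesky_factorization:
  assumes sym: "semi_infinite_transpose G = G" and S: "orthogonalizes G S"
  shows "\<exists>H. cholesky_factorization G S H"
proof -
  define T where "T = unitriangular_inverse S"
  define H where "H = (S \<odot> G) \<odot> semi_infinite_transpose S"
  have uniS: "lower_unitriangular S" and uniT: "lower_unitriangular T"
    using S by (auto simp: orthogonalizes_def T_def lower_unitriangular_inverse)
  have ST: "S \<odot> T = semi_infinite_id" and TS: "T \<odot> S = semi_infinite_id"
    unfolding T_def using uniS
    by (rule unitriangular_right_inverse, rule unitriangular_left_inverse)
  have S0: "S i j = 0" and T0: "T i j = 0" if "i < j" for i j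
    using uniS uniT that by (auto intro: lower_unitriangular_above)
  have S0': "semi_infinite_transpose S i j = 0" and T0': "semi_infinite_transpose T i j = 0"
    if "j < i" for i j
    using S0 T0 that by (auto simp: semi_infinite_transpose_def)
  have H_below: "H i j = 0" if "j < i" for i j
  proof -
    have "H i j = (\<Sum>l\<le>j. (S \<odot> G) i l * semi_infinite_transpose S l j)"
      unfolding H_def by (rule semi_infinite_mult_right_upper) (rule S0')
    moreover have "(S \<odot> G) i l = 0" if "l \<le> j" for l
    proof -
      have "(S \<odot> G) i l = (\<Sum>m\<le>i. S i m * G m l)"
        by (rule semi_infinite_mult_left_lower) (rule S0)
      then show ?thesis
        using S \<open>j < i\<close> that by (simp add: orthogonalizes_def)
    qed
    ultimately show ?thesis
      by simp
  qed
  have "semi_infinite_transpose H = S \<odot> (G \<odot> semi_infinite_transpose S)"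
    by (simp add: H_def semi_infinite_transpose_mult sym)
  also have "\<dots> = H"
    unfolding H_def by (rule semi_infinite_mult_assoc_lower_upper[symmetric]) (simp_all add: S0 S0')
  finally have "H j i = H i j" for i j
    by (metis semi_infinite_transpose_def)
  then have "diagonal H"
    using H_below by (metis diagonal_def nat_neq_iff)
  moreover have "G = T \<odot> H \<odot> semi_infinite_transpose T"
  proof -
    have "T \<odot> H = (T \<odot> (S \<odot> G)) \<odot> semi_infinite_transpose S"
      unfolding H_def by (rule semi_infinite_mult_assoc_lower_upper[symmetric]) (simp_all add: T0 S0')
    also have "T \<odot> (S \<odot> G) = (T \<odot> S) \<odot> G"
      by (rule semi_infinite_mult_assoc_lower_lower[symmetric]) (simp_all add: T0 S0)
    finally have "T \<odot> H \<odot> semi_infinite_transpose T =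
        (G \<odot> semi_infinite_transpose S) \<odot> semi_infinite_transpose T"
      by (simp add: TS)
    also have "\<dots> = G \<odot> (semi_infinite_transpose S \<odot> semi_infinite_transpose T)"
      by (rule semi_infinite_mult_assoc_upper_upper) (simp_all add: S0' T0')
    also have "semi_infinite_transpose S \<odot> semi_infinite_transpose T = semi_infinite_id"
    proof -
      have "semi_infinite_transpose S \<odot> semi_infinite_transpose T = semi_infinite_transpose (T \<odot> S)"
        by (simp add: semi_infinite_transpose_mult)
      then show ?thesis
        by (simp add: TS) (auto simp: semi_infinite_transpose_def semi_infinite_id_def fun_eq_iff)
    qed
    finally show ?thesis
      by simp
  qed
  ultimately show ?thesis
    using uniS uniT ST TS unfolding cholesky_factorization_def by blast
qed

lemma truncation_left_kernel:
  assumes det: "Determinant.det (truncation G k) \<noteq> 0"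
    and zero: "\<And>j. j < k \<Longrightarrow> (\<Sum>l<k. d l * G l j) = 0" and "l < k"
  shows "d l = 0"
proof -
  let ?A = "transpose_mat (truncation G k)"
  have A: "?A \<in> carrier_mat k k"
    by (simp add: truncation_def)
  have "?A *\<^sub>v vec k d = 0\<^sub>v k"
    using zero by (intro eq_vecI)
      (auto simp: truncation_def scalar_prod_def atLeast0LessThan mult.commute)
  moreover have "Determinant.det ?A \<noteq> 0"
    using det by (simp add: det_transpose[of _ k] truncation_def)
  ultimately have "vec k d = 0\<^sub>v k"
    using det_0_iff_vec_prod_zero_field[of ?A k] vec_carrier[of k d] A by blast
  then show ?thesis
    using \<open>l < k\<close> by (metis index_vec index_zero_vec(1))
qed

text \<open>
  The difference of the two rows with index \<open>k\<close> has no entry at \<open>k\<close>, where both are \<open>1\<close>, so it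
  is a vector of length \<open>k\<close> in the left kernel of the invertible truncation.
\<close>

lemma orthogonalizes_unique:
  assumes G: "quasi_definite G" and S: "orthogonalizes G S" and S': "orthogonalizes G S'"
  shows "S = S'"
proof (intro ext)
  fix k l
  have uni: "lower_unitriangular S" "lower_unitriangular S'"
    using S S' by (auto simp: orthogonalizes_def)
  show "S k l = S' k l"
  proof (cases "l < k")
    case True
    have split: "{..k} = insert k {..<k}"
      by auto
    have "(\<Sum>m<k. (S k m - S' k m) * G m j) = 0" if "j < k" for j
    proof -
      have "(\<Sum>m\<le>k. S k m * G m j) = (\<Sum>m\<le>k. S' k m * G m j)"
        using S S' that by (simp add: orthogonalizes_def)
      then show ?thesis
        using uni by (simp add: split lower_unitriangular_diag sum_subtractf left_diff_distrib)
    qed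
    moreover have "Determinant.det (truncation G k) \<noteq> 0"
      using G True by (simp add: quasi_definite_def)
    ultimately have "S k l - S' k l = 0"
      using truncation_left_kernel[of G k "\<lambda>m. S k m - S' k m" l] True by blast
    then show ?thesis
      by simp
  next
    case False
    then show ?thesis
      using uni by (cases "l = k") (auto simp: lower_unitriangular_def)
  qed
qed

text \<open>
  The entries of row \<open>k\<close> before the diagonal solve a \<open>k \<times> k\<close> linear system whose matrix is the
  transposed truncation and whose right-hand side comes from the diagonal entry \<open>1\<close>.
\<close>

lemma orthogonalizes_exists:
  assumes G: "quasi_definite G"
  shows "\<exists>S. orthogonalizes G S"
proof -
  have "\<exists>r. \<forall>j<k. (\<Sum>l<k. r l * G l j) = - G k j" for k
  proof (cases "k = 0")
    case False
    let ?A = "transpose_mat (truncation G k)"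
    have A: "?A \<in> carrier_mat k k"
      by (simp add: truncation_def)
    have "Determinant.det ?A \<noteq> 0"
      using G False by (subst det_transpose[of _ k]) (auto simp: truncation_def quasi_definite_def)
    then have "\<exists>B. B \<in> carrier_mat k k \<and> ?A * B = 1\<^sub>m k"
      using det_non_zero_imp_unit[OF A, of "()"] by (auto simp: Units_def ring_mat_def)
    then obtain B where B: "B \<in> carrier_mat k k" "?A * B = 1\<^sub>m k"
      by blast
    define b where "b = vec k (\<lambda>j. - G k j)"
    define r where "r = B *\<^sub>v b"
    have r_dim: "r \<in> carrier_vec k"
      using B by (simp add: r_def b_def)
    have "?A *\<^sub>v r = (?A * B) *\<^sub>v b"
      unfolding r_def using A B(1) by (intro assoc_mult_mat_vec[symmetric]) (auto simp: b_def)
    also have "\<dots> = b"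
      by (simp add: B b_def)
    finally have solve: "?A *\<^sub>v r = b" .
    have "(\<Sum>l<k. r $ l * G l j) = - G k j" if "j < k" for j
    proof -
      have "(?A *\<^sub>v r) $ j = (\<Sum>l<k. r $ l * G l j)"
        using that r_dim by (simp add: truncation_def scalar_prod_def atLeast0LessThan mult.commute)
      then show ?thesis
        using that by (simp add: solve b_def)
    qed
    then show ?thesis
      by blast
  qed simp
  then obtain r where r: "\<And>k j. j < k \<Longrightarrow> (\<Sum>l<k. r k l * G l j) = - G k j"
    by metis
  define S where "S k l = (if l < k then r k l else if l = k then 1 else 0)" for k l
  have "(\<Sum>l\<le>k. S k l * G l j) = 0" if "j < k" for k j
  proof -
    have "{..k} = insert k {..<k}"
      by auto
    then have "(\<Sum>l\<le>k. S k l * G l j) = G k j + (\<Sum>l<k. r k l * G l j)"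
      by (simp add: S_def)
    then show ?thesis
      using r[OF that] by simp
  qed
  then have "orthogonalizes G S"
    by (simp add: orthogonalizes_def lower_unitriangular_def S_def)
  then show ?thesis
    by blast
qed

lemma cholesky_factor_orthogonalizes:
  assumes "quasi_definite G" "semi_infinite_transpose G = G"
  shows "orthogonalizes G (cholesky_factor G)"
proof -
  obtain S where S: "orthogonalizes G S"
    using orthogonalizes_exists[OF assms(1)] by blast
  have "cholesky_factor G = S"
    unfolding cholesky_factor_def
  proof (rule the_equality)
    show "\<exists>H. cholesky_factorization G S H"
      using assms(2) S by (rule orthogonalizes_cholesky_factorization)
    show "S' = S" if "\<exists>H. cholesky_factorization G S' H" for S'
      using that orthogonalizes_unique[OF assms(1) _ S] cholesky_factorization_orthogonalizes
      by blast
  qed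
  with S show ?thesis
    by simp
qed

text \<open>
  This is the classical determinant formula for orthogonal polynomials. Combining the columns
  with the rows of \<open>S\<close> replaces \<open>x\<^sup>j\<close> in the last row by the orthogonal polynomial of degree \<open>j\<close>
  and, by orthogonality, makes the moment part lower triangular with some diagonal \<open>W i i\<close>. The
  same operation on the truncation leaves exactly the diagonal entries before the last one,
  so the two determinants differ by the factor in the lower right corner.
\<close>

lemma det_moments_with_powers:
  assumes S: "orthogonalizes G S" and sym: "semi_infinite_transpose G = G"
  shows "Determinant.det (mat (Suc k) (Suc k) (\<lambda>(i, j). if i < k then G i j else x ^ j)) =
    Determinant.det (truncation G k) * (\<Sum>j\<le>k. S k j * x ^ j)"
proof -
  have uni: "\<And>j. S j j = 1"
    using S by (simp add: orthogonalizes_def lower_unitriangular_diag)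
  have G_sym: "G i j = G j i" for i j
    using sym by (metis semi_infinite_transpose_def)
  define W where "W i j = (\<Sum>l\<le>j. S j l * G i l)" for i j
  have W0: "W i j = 0" if "i < j" for i j
  proof -
    have "W i j = (\<Sum>l\<le>j. S j l * G l i)"
      unfolding W_def by (simp only: G_sym[of i])
    then show ?thesis
      using S that by (simp add: orthogonalizes_def)
  qed
  have "Determinant.det (truncation G k) = Determinant.det (mat k k (\<lambda>(i, j). W i j))"
    unfolding truncation_def W_def
    by (rule det_unitriangular_column_change[OF uni, symmetric])
  also have "\<dots> = (\<Prod>i<k. W i i)"
    by (rule det_lower_triangular_prod) (rule W0)
  finally have det_G: "Determinant.det (truncation G k) = (\<Prod>i<k. W i i)" .
  define M where "M i j = (if i < k then G i j else x ^ j)" for i j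
  define V where "V i j = (\<Sum>l\<le>j. S j l * M i l)" for i j
  have V_eq: "V i j = W i j" if "i < k" for i j
    using that by (simp add: V_def W_def M_def)
  have "Determinant.det (mat (Suc k) (Suc k) (\<lambda>(i, j). M i j)) =
      Determinant.det (mat (Suc k) (Suc k) (\<lambda>(i, j). V i j))"
    unfolding V_def by (rule det_unitriangular_column_change[OF uni, symmetric])
  also have "\<dots> = (\<Prod>i<Suc k. V i i)"
    by (rule det_lower_triangular_prod) (simp add: V_eq W0)
  also have "\<dots> = (\<Prod>i<k. W i i) * V k k"
    by (simp add: V_eq)
  also have "V k k = (\<Sum>j\<le>k. S k j * x ^ j)"
    by (simp add: V_def M_def)
  finally show ?thesis
    by (simp add: M_def det_G)
qed


section \<open>Heine's formula\<close>

lemma prod_increasing_pairs: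
  "(\<Prod>(j, n)\<in>{(j, n). 1 \<le> j \<and> j < n \<and> n \<le> k}. f j n) = (\<Prod>i<k. \<Prod>l<i. f (Suc l) (Suc i))"
proof -
  have "(\<Prod>i<k. \<Prod>l<i. f (Suc l) (Suc i)) =
      (\<Prod>(i, l)\<in>(SIGMA i:{..<k}. {..<i}). f (Suc l) (Suc i))"
    by (rule prod.Sigma) auto
  also have "\<dots> = (\<Prod>(j, n)\<in>{(j, n). 1 \<le> j \<and> j < n \<and> n \<le> k}. f j n)"
    by (rule prod.reindex_bij_witness[where i = "\<lambda>(j, n). (n - 1, j - 1)"
          and j = "\<lambda>(i, l). (Suc l, Suc i)"]) auto
  finally show ?thesis ..
qed

text \<open>
  One of the two factors \<open>t n - t j\<close> of each pair builds the Vandermonde determinant of the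
  variables; the other one, together with the factors \<open>x - t j\<close>, builds that of the variables
  followed by the node \<open>x\<close>.
\<close>

lemma integrand_as_vandermonde_product:
  fixes t :: "nat \<Rightarrow> real" and x :: complex
  shows "(\<Prod>j=1..k. x - complex_of_real (t j)) *
      (\<Prod>(j, n)\<in>{(j, n). 1 \<le> j \<and> j < n \<and> n \<le> k}. (complex_of_real (t n - t j))\<^sup>2) =
    Determinant.det (mat (Suc k) (Suc k)
      (\<lambda>(i, j). (if i < k then complex_of_real (t (Suc i)) else x) ^ j)) *
    Determinant.det (mat k k (\<lambda>(i, j). complex_of_real (t (Suc i)) ^ j))"
proof -
  define z where "z i = (if i < k then complex_of_real (t (Suc i)) else x)" for i
  have "(\<Prod>(j, n)\<in>{(j, n). 1 \<le> j \<and> j < n \<and> n \<le> k}. (complex_of_real (t n - t j))\<^sup>2) =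
      (\<Prod>i<k. \<Prod>l<i. complex_of_real (t (Suc i)) - complex_of_real (t (Suc l)))\<^sup>2"
    unfolding prod_increasing_pairs by (simp add: prod_power_distrib)
  moreover have "(\<Prod>i<Suc k. \<Prod>l<i. z i - z l) =
      (\<Prod>i<k. \<Prod>l<i. complex_of_real (t (Suc i)) - complex_of_real (t (Suc l))) *
      (\<Prod>j=1..k. x - complex_of_real (t j))"
    by (simp add: z_def prod.atLeast1_atMost_eq)
  moreover have "Determinant.det (mat (Suc k) (Suc k) (\<lambda>(i, j). z i ^ j)) =
      (\<Prod>i<Suc k. \<Prod>l<i. z i - z l)"
    by (rule det_vandermonde)
  ultimately show ?thesis
    by (simp add: det_vandermonde z_def[symmetric] power2_eq_square mult_ac)
qed

text \<open>
  Undoing the permutation of the first \<open>k\<close> rows costs its sign, which cancels the sign in front,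
  so that all \<open>k!\<close> summands agree.
\<close>

lemma sum_signed_row_permutations:
  fixes g :: "nat \<Rightarrow> nat \<Rightarrow> 'a::{comm_ring_1,ring_char_0}"
  shows "(\<Sum>\<sigma> | \<sigma> permutes {0..<k}. signof \<sigma> *
      Determinant.det (mat (Suc k) (Suc k) (\<lambda>(i, j). if i < k then g (\<sigma> i) j else y j))) =
    fact k * Determinant.det (mat (Suc k) (Suc k) (\<lambda>(i, j). if i < k then g i j else y j))"
proof -
  define D where "D = mat (Suc k) (Suc k) (\<lambda>(i, j). if i < k then g i j else y j)"
  have "signof \<sigma> * Determinant.det (mat (Suc k) (Suc k)
      (\<lambda>(i, j). if i < k then g (\<sigma> i) j else y j)) = Determinant.det D"
    if \<sigma>: "\<sigma> permutes {0..<k}" for \<sigma>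
  proof -
    have \<sigma>': "\<sigma> permutes {0..<Suc k}"
      using \<sigma> by (rule permutes_subset) auto
    have "\<sigma> i < k \<longleftrightarrow> i < k" for i
      using permutes_in_image[OF \<sigma>, of i] by simp
    moreover have "\<sigma> i < Suc k" if "i < Suc k" for i
      using permutes_in_image[OF \<sigma>', of i] that by simp
    ultimately have "mat (Suc k) (Suc k) (\<lambda>(i, j). if i < k then g (\<sigma> i) j else y j) =
        mat (Suc k) (Suc k) (\<lambda>(i, j). D $$ (\<sigma> i, j))"
      by (intro eq_matI) (auto simp: D_def)
    also have "Determinant.det \<dots> = signof \<sigma> * Determinant.det D"
      by (rule det_permute_rows[OF _ \<sigma>']) (simp add: D_def)
    finally show ?thesis
      by (simp add: mult.assoc[symmetric] sign_idempotent flip: of_int_mult)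
  qed
  then have "(\<Sum>\<sigma> | \<sigma> permutes {0..<k}. signof \<sigma> * Determinant.det (mat (Suc k) (Suc k)
      (\<lambda>(i, j). if i < k then g (\<sigma> i) j else y j))) =
      of_nat (card {\<sigma>. \<sigma> permutes {0..<k}}) * Determinant.det D"
    by simp
  also have "card {\<sigma>. \<sigma> permutes {0..<k}} = fact k"
    by (rule card_permutations) auto
  finally show ?thesis
    by (simp add: D_def)
qed

text \<open>
  Both determinants are expanded over permutations \<open>\<tau>\<close> of \<open>k + 1\<close> and \<open>\<sigma>\<close> of \<open>k\<close> indices. The
  variable with index \<open>i\<close> occurs with exponent \<open>\<tau> i + \<sigma> i\<close> and integrates to the moment of that
  order. For a fixed \<open>\<sigma>\<close> the sum over \<open>\<tau>\<close> is again a determinant, namely the one on the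
  right-hand side with its first \<open>k\<close> rows permuted by \<open>\<sigma>\<close>.
\<close>

lemma multiple_integral_vandermonde_product:
  assumes "complex_borel_measure \<mu>" "finite_abs_moments \<mu>"
  shows "multiple_integral \<mu> k (\<lambda>t.
      Determinant.det (mat (Suc k) (Suc k)
        (\<lambda>(i, j). (if i < k then complex_of_real (t (Suc i)) else x) ^ j)) *
      Determinant.det (mat k k (\<lambda>(i, j). complex_of_real (t (Suc i)) ^ j))) =
    fact k * Determinant.det (mat (Suc k) (Suc k)
      (\<lambda>(i, j). if i < k then moment_matrix \<mu> i j else x ^ j))"
proof -
  let ?P = "\<lambda>n. {p. p permutes {0..<n}}"
  let ?z = "\<lambda>t i. if i < k then complex_of_real (t (Suc i)) else x"
  let ?m = "\<lambda>n. complex_integral \<mu> (\<lambda>s. complex_of_real (s ^ n))"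
  have expand: "Determinant.det (mat (Suc k) (Suc k) (\<lambda>(i, j). ?z t i ^ j)) *
      Determinant.det (mat k k (\<lambda>(i, j). complex_of_real (t (Suc i)) ^ j)) =
    (\<Sum>(\<tau>, \<sigma>)\<in>?P (Suc k) \<times> ?P k. signof \<tau> * signof \<sigma> * x ^ \<tau> k *
      (\<Prod>i<k. complex_of_real (t (Suc i)) ^ (\<tau> i + \<sigma> i)))" for t
  proof -
    have big: "Determinant.det (mat (Suc k) (Suc k) (\<lambda>(i, j). ?z t i ^ j)) =
        (\<Sum>\<tau>\<in>?P (Suc k). signof \<tau> *
          ((\<Prod>i<k. complex_of_real (t (Suc i)) ^ \<tau> i) * x ^ \<tau> k))"
    proof -
      have "(\<Prod>i = 0..<Suc k. mat (Suc k) (Suc k) (\<lambda>(i, j). ?z t i ^ j) $$ (i, \<tau> i)) =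
          (\<Prod>i<k. complex_of_real (t (Suc i)) ^ \<tau> i) * x ^ \<tau> k"
        if "\<tau> \<in> ?P (Suc k)" for \<tau>
      proof -
        have "\<tau> i < Suc k" if "i < Suc k" for i
          using \<open>\<tau> \<in> ?P (Suc k)\<close> permutes_in_image[of \<tau> "{0..<Suc k}" i] that by simp
        then show ?thesis
          by (simp add: atLeast0LessThan)
      qed
      then show ?thesis
        by (subst det_def'[of _ "Suc k"]) (simp_all del: prod.op_ivl_Suc)
    qed
    have small: "Determinant.det (mat k k (\<lambda>(i, j). complex_of_real (t (Suc i)) ^ j)) =
        (\<Sum>\<sigma>\<in>?P k. signof \<sigma> * (\<Prod>i<k. complex_of_real (t (Suc i)) ^ \<sigma> i))"
    proof -
      have "(\<Prod>i = 0..<k. mat k k (\<lambda>(i, j). complex_of_real (t (Suc i)) ^ j) $$ (i, \<sigma> i)) =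
          (\<Prod>i<k. complex_of_real (t (Suc i)) ^ \<sigma> i)"
        if "\<sigma> \<in> ?P k" for \<sigma>
      proof -
        have "\<sigma> i < k" if "i < k" for i
          using \<open>\<sigma> \<in> ?P k\<close> permutes_in_image[of \<sigma> "{0..<k}" i] that by simp
        then show ?thesis
          by (simp add: atLeast0LessThan)
      qed
      then show ?thesis
        by (subst det_def'[of _ k]) simp_all
    qed
    show ?thesis
      unfolding big small sum_product sum.cartesian_product
      by (intro sum.cong) (auto simp: power_add prod.distrib mult_ac)
  qed
  have det_moments: "Determinant.det (mat (Suc k) (Suc k)
      (\<lambda>(i, j). if i < k then ?m (\<sigma> i + j) else x ^ j)) =
    (\<Sum>\<tau>\<in>?P (Suc k). signof \<tau> * ((\<Prod>i<k. ?m (\<tau> i + \<sigma> i)) * x ^ \<tau> k))" for \<sigma>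
  proof -
    have "(\<Prod>i = 0..<Suc k. mat (Suc k) (Suc k)
          (\<lambda>(i, j). if i < k then ?m (\<sigma> i + j) else x ^ j) $$ (i, \<tau> i)) =
        (\<Prod>i<k. ?m (\<tau> i + \<sigma> i)) * x ^ \<tau> k"
      if "\<tau> \<in> ?P (Suc k)" for \<tau>
    proof -
      have "\<tau> i < Suc k" if "i < Suc k" for i
        using \<open>\<tau> \<in> ?P (Suc k)\<close> permutes_in_image[of \<tau> "{0..<Suc k}" i] that by simp
      then show ?thesis
        by (simp add: atLeast0LessThan add.commute)
    qed
    then show ?thesis
      by (subst det_def'[of _ "Suc k"]) (simp_all del: prod.op_ivl_Suc)
  qed
  have "multiple_integral \<mu> k (\<lambda>t. Determinant.det (mat (Suc k) (Suc k) (\<lambda>(i, j). ?z t i ^ j)) *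
      Determinant.det (mat k k (\<lambda>(i, j). complex_of_real (t (Suc i)) ^ j))) =
    (\<Sum>(\<tau>, \<sigma>)\<in>?P (Suc k) \<times> ?P k.
      signof \<tau> * signof \<sigma> * x ^ \<tau> k * (\<Prod>i<k. ?m (\<tau> i + \<sigma> i)))"
    unfolding expand
    using multiple_integral_polynomial[OF assms, where k = k and I = "?P (Suc k) \<times> ?P k"
        and c = "\<lambda>(\<tau>, \<sigma>). signof \<tau> * signof \<sigma> * x ^ \<tau> k" and e = "\<lambda>(\<tau>, \<sigma>) i. \<tau> i + \<sigma> i"]
    by (simp only: split_def)
  also have "\<dots> = (\<Sum>\<tau>\<in>?P (Suc k). \<Sum>\<sigma>\<in>?P k.
      signof \<tau> * signof \<sigma> * x ^ \<tau> k * (\<Prod>i<k. ?m (\<tau> i + \<sigma> i)))"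
    by (rule sum.cartesian_product[symmetric])
  also have "\<dots> = (\<Sum>\<sigma>\<in>?P k. \<Sum>\<tau>\<in>?P (Suc k).
      signof \<tau> * signof \<sigma> * x ^ \<tau> k * (\<Prod>i<k. ?m (\<tau> i + \<sigma> i)))"
    by (rule sum.swap)
  also have "\<dots> = (\<Sum>\<sigma>\<in>?P k. signof \<sigma> * Determinant.det (mat (Suc k) (Suc k)
      (\<lambda>(i, j). if i < k then ?m (\<sigma> i + j) else x ^ j)))"
    unfolding det_moments sum_distrib_left by (intro sum.cong refl) (simp only: mult_ac)
  also have "\<dots> = fact k * Determinant.det (mat (Suc k) (Suc k)
      (\<lambda>(i, j). if i < k then ?m (i + j) else x ^ j))"
    by (rule sum_signed_row_permutations)
  finally show ?thesis
    by (simp only: moment_matrix_def)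
qed

theorem proposition17:
  fixes \<mu> :: "real set \<Rightarrow> complex" and k :: nat and x :: complex
  assumes "complex_borel_measure \<mu>"
    and "finite_abs_moments \<mu>"
    and "quasi_definite (moment_matrix \<mu>)"
    and "k \<ge> 1"
  shows "poly (monic_orthogonal_poly \<mu> k) x =
    1 / (fact k * Determinant.det (truncation (moment_matrix \<mu>) k)) *
    multiple_integral \<mu> k (\<lambda>t.
      (\<Prod>j=1..k. x - complex_of_real (t j)) *
      (\<Prod>(j, n)\<in>{(j, n). 1 \<le> j \<and> j < n \<and> n \<le> k}. (complex_of_real (t n - t j))\<^sup>2))"
proof -
  let ?G = "moment_matrix \<mu>"
  have sym: "semi_infinite_transpose ?G = ?G"
    by (intro ext) (simp add: semi_infinite_transpose_def moment_matrix_def add.commute)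
  have "multiple_integral \<mu> k (\<lambda>t.
      (\<Prod>j=1..k. x - complex_of_real (t j)) *
      (\<Prod>(j, n)\<in>{(j, n). 1 \<le> j \<and> j < n \<and> n \<le> k}. (complex_of_real (t n - t j))\<^sup>2)) =
    fact k * Determinant.det (mat (Suc k) (Suc k) (\<lambda>(i, j). if i < k then ?G i j else x ^ j))"
    unfolding integrand_as_vandermonde_product
    using assms(1,2) by (rule multiple_integral_vandermonde_product)
  also have "Determinant.det (mat (Suc k) (Suc k) (\<lambda>(i, j). if i < k then ?G i j else x ^ j)) =
      Determinant.det (truncation ?G k) * (\<Sum>j\<le>k. cholesky_factor ?G k j * x ^ j)"
    using cholesky_factor_orthogonalizes[OF assms(3) sym] sym by (rule det_moments_with_powers)
  also have "(\<Sum>j\<le>k. cholesky_factor ?G k j * x ^ j) = poly (monic_orthogonal_poly \<mu> k) x"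
    by (simp add: monic_orthogonal_poly_def poly_sum poly_monom)
  finally show ?thesis
    using assms(3,4) by (simp add: quasi_definite_def)
qed

end
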